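(* Let $n\ge 3$. The set $\mathbb{L}(n)\subset\mathbb{C}^n$ is an $(n+2)$-manifold (real dimension $n+2$) diffeomorphic to $\mathbb{M}(n)\times\mathbb{C}$.
   Context: Let $n\ge 3$ and $\mathcal{D}_n=\{(b,\dots,b)\in\mathbb{C}^n : b\in\mathbb{C}\}$. $\mathbb{L}(n)\subset\mathbb{C}^n$ is the set of $n$-segments: points $(z_1,\dots,z_n)\in\mathbb{C}^n\smallsetminus\mathcal{D}_n$ such that $z_1,\dots,z_n$ lie on a common real straight line in $\mathbb{C}$. Let $V_n=\{(0,z_2,\dots,z_n)\in\mathbb{C}^n\}$ and $\mathbb{M}(n)=\mathbb{L}(n)\cap V_n$; equivalently, $\mathbb{M}(n)=\{aX : a\in\mathbb{C}\smallsetminus\{0\},\ X\in (V_n\cap\mathbb{R}^n)\smallsetminus\{\vec 0\}\}$, which is a smooth real $n$-dimensional submanifold of $\mathbb{C}^n$. "Manifold" here means a smooth real submanifold of $\mathbb{C}^n\cong\mathbb{R}^{2n}$. *)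

theory Defs
  imports "HOL-Analysis.Analysis"
begin

text \<open>Smoothness is \<open>C\<^sup>\<infinity>\<close> over the reals; \<open>complex ^ 'n\<close> carries the real Euclidean structure of
  dimension \<open>2 * CARD('n)\<close>. The next two definitions are meant for open \<open>U\<close>.\<close>

primrec Ck_on :: "nat \<Rightarrow> 'a::euclidean_space set \<Rightarrow> ('a \<Rightarrow> 'b::euclidean_space) \<Rightarrow> bool" where
  "Ck_on 0 U f \<longleftrightarrow> continuous_on U f"
| "Ck_on (Suc k) U f \<longleftrightarrow> (\<forall>x\<in>U. f differentiable (at x)) \<and>
     (\<forall>v. Ck_on k U (\<lambda>x. frechet_derivative f (at x) v))"

definition smooth_on_open :: "'a::euclidean_space set \<Rightarrow> ('a \<Rightarrow> 'b::euclidean_space) \<Rightarrow> bool" where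
  "smooth_on_open U f \<longleftrightarrow> (\<forall>k. Ck_on k U f)"

text \<open>A map on an arbitrary subset of a Euclidean space is smooth if it locally extends to a smooth
  map on an open subset of the ambient space. On embedded submanifolds this is smoothness in charts.\<close>

definition smooth_map_on :: "'a::euclidean_space set \<Rightarrow> ('a \<Rightarrow> 'b::euclidean_space) \<Rightarrow> bool" where
  "smooth_map_on S f \<longleftrightarrow>
     (\<forall>p\<in>S. \<exists>U g. open U \<and> p \<in> U \<and> smooth_on_open U g \<and> (\<forall>x\<in>S \<inter> U. g x = f x))"

definition diffeomorphism ::
  "'a::euclidean_space set \<Rightarrow> 'b::euclidean_space set \<Rightarrow> ('a \<Rightarrow> 'b) \<Rightarrow> ('b \<Rightarrow> 'a) \<Rightarrow> bool" where
  "diffeomorphism S T f g \<longleftrightarrow> homeomorphism S T f g \<and> smooth_map_on S f \<and> smooth_map_on T g"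

definition diffeomorphic :: "'a::euclidean_space set \<Rightarrow> 'b::euclidean_space set \<Rightarrow> bool"
  (infixr "diffeomorphic" 60) where
  "S diffeomorphic T \<longleftrightarrow> (\<exists>f g. diffeomorphism S T f g)"

text \<open>Embedded \<open>k\<close>-dimensional submanifolds, by slice charts of the ambient space. A linear subspace
  \<open>W\<close> of dimension \<open>k\<close> plays the role of \<open>\<real>\<^sup>k \<times> {0}\<close>.\<close>

definition smooth_submanifold :: "nat \<Rightarrow> 'a::euclidean_space set \<Rightarrow> bool" where
  "smooth_submanifold k S \<longleftrightarrow>
     (\<forall>p\<in>S. \<exists>(U :: 'a set) (V :: 'a set) W \<phi> \<psi>. open U \<and> p \<in> U \<and> open V \<and> diffeomorphism U V \<phi> \<psi> \<and>
        subspace W \<and> dim W = k \<and> \<phi> ` (S \<inter> U) = W \<inter> V)"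

definition diag_set :: "(complex ^ 'n) set" where
  "diag_set = range (\<lambda>b. \<chi> i. b)"

text \<open>\<open>collinear\<close> refers to the real vector space structure of \<open>complex\<close>.\<close>

definition n_segments :: "(complex ^ 'n) set" where
  "n_segments = {z. z \<notin> diag_set \<and> collinear (range (\<lambda>i. z $ i))}"

text \<open>As the index type carries no order, the index \<open>j\<close> of the first coordinate is a parameter.\<close>

definition first_zero :: "'n \<Rightarrow> (complex ^ 'n) set" where
  "first_zero j = {z. z $ j = 0}"

definition zero_segments :: "'n \<Rightarrow> (complex ^ 'n) set" where
  "zero_segments j = n_segments \<inter> first_zero j"

end

theory Submission
  imports Defs
begin

text \<open>Translation by the coordinate \<open>z\<^sub>j\<close> is linear and splits a segment into one with vanishing
  \<open>j\<close>-th coordinate and a point of \<open>\<complex>\<close>. On the open set \<open>z\<^sub>k \<noteq> z\<^sub>j\<close>, a slice chart replaces every remaining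
  coordinate \<open>z\<^sub>i\<close> by the ratio \<open>(z\<^sub>i - z\<^sub>j) / (z\<^sub>k - z\<^sub>j)\<close>: the points are collinear exactly when all
  these ratios are real.\<close>

section \<open>Smooth maps\<close>

text \<open>The derivative at a point depends only on values nearby. As \<open>U\<close> is open,
  agreement on \<open>U\<close> passes to all derivatives there, so an induction on the order
  works.\<close>

lemma Ck_on_cong:
  assumes "open U" "Ck_on k U g" "\<And>x. x \<in> U \<Longrightarrow> g x = h x"
  shows "Ck_on k U h"
  using assms(2,3)
proof (induction k arbitrary: g h)
  case 0
  then show ?case
    using continuous_on_cong[OF refl, of U g h] by simp
next
  case (Suc k)
  have h: "(h has_derivative frechet_derivative g (at x)) (at x)" if x: "x \<in> U" for x
  proof -
    have "(g has_derivative frechet_derivative g (at x)) (at x)"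
      using Suc.prems(1) x frechet_derivative_works by auto
    then show ?thesis
      using has_derivative_transform_within_open[OF _ \<open>open U\<close> x] Suc.prems(2) by blast
  qed
  have "Ck_on k U (\<lambda>x. frechet_derivative h (at x) v)" for v
  proof (rule Suc.IH)
    show "Ck_on k U (\<lambda>x. frechet_derivative g (at x) v)"
      using Suc.prems(1) by simp
    show "frechet_derivative g (at x) v = frechet_derivative h (at x) v" if "x \<in> U" for x
      using frechet_derivative_at[OF h[OF that]] by simp
  qed
  moreover have "\<forall>x\<in>U. h differentiable at x"
    using h differentiableI by blast
  ultimately show ?case by simp
qed

text \<open>By uniqueness of derivatives, any explicit formula \<open>f'\<close> may stand in for
  \<open>frechet_derivative\<close>. The closure properties below rest on this rule.\<close>

lemma Ck_on_SucI:
  assumes "open U" "\<And>x. x \<in> U \<Longrightarrow> (f has_derivative f' x) (at x)"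
    and "\<And>v. Ck_on k U (\<lambda>x. f' x v)"
  shows "Ck_on (Suc k) U f"
proof -
  have "Ck_on k U (\<lambda>x. frechet_derivative f (at x) v)" for v
  proof (rule Ck_on_cong[OF assms(1) assms(3)[of v]])
    show "f' x v = frechet_derivative f (at x) v" if "x \<in> U" for x
      using frechet_derivative_at[OF assms(2)[OF that]] by simp
  qed
  then show ?thesis
    using assms(2) differentiableI by fastforce
qed

lemma Ck_on_Suc_has_derivative:
  assumes "Ck_on (Suc k) U f" "x \<in> U"
  shows "(f has_derivative frechet_derivative f (at x)) (at x)"
  using assms frechet_derivative_works by auto

lemma Ck_on_SucD: "Ck_on (Suc k) U f \<Longrightarrow> Ck_on k U f"
proof (induction k arbitrary: f)
  case 0
  then show ?case
    by (auto intro!: continuous_at_imp_continuous_on differentiable_imp_continuous_within)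
next
  case (Suc k)
  then show ?case by (metis Ck_on.simps(2))
qed

section \<open>Closure properties of the classes \<open>Ck_on\<close>\<close>

lemma Ck_on_const: "open U \<Longrightarrow> Ck_on k U (\<lambda>x. c)"
proof (induction k arbitrary: c)
  case (Suc k)
  show ?case
    by (rule Ck_on_SucI[where f' = "\<lambda>_ _. 0"]) (use Suc in auto)
qed auto

text \<open>A linear map is its own derivative at every point, so each directional derivative is
  constant. A case split replaces the induction.\<close>

lemma Ck_on_bounded_linear:
  assumes "open U" "bounded_linear f"
  shows "Ck_on k U f"
proof (cases k)
  case 0
  then show ?thesis
    using assms by (simp add: linear_continuous_on)
next
  case (Suc k)
  show ?thesis
    unfolding Suc
    by (rule Ck_on_SucI[where f' = "\<lambda>_. f"])
      (use assms in \<open>auto intro: bounded_linear_imp_has_derivative Ck_on_const\<close>)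
qed

lemma Ck_on_bounded_linear_compose:
  assumes "open U" "bounded_linear h" "Ck_on k U f"
  shows "Ck_on k U (\<lambda>x. h (f x))"
  using assms(3)
proof (induction k arbitrary: f)
  case 0
  then show ?case
    using bounded_linear.continuous_on[OF assms(2)] by auto
next
  case (Suc k)
  show ?case
    by (rule Ck_on_SucI[where f' = "\<lambda>x v. h (frechet_derivative f (at x) v)"])
      (use Suc assms in \<open>auto intro!: bounded_linear.has_derivative[OF assms(2)]
        Ck_on_Suc_has_derivative\<close>)
qed

lemma Ck_on_add:
  assumes "open U" "Ck_on k U f" "Ck_on k U g"
  shows "Ck_on k U (\<lambda>x. f x + g x)"
  using assms(2,3)
proof (induction k arbitrary: f g)
  case 0
  then show ?case
    by (auto intro: continuous_intros)
next
  case (Suc k)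
  show ?case
    by (rule Ck_on_SucI[where
          f' = "\<lambda>x v. frechet_derivative f (at x) v + frechet_derivative g (at x) v"])
      (use Suc assms(1) in \<open>auto intro!: has_derivative_add Ck_on_Suc_has_derivative\<close>)
qed

lemma Ck_on_sum:
  assumes "open U" "\<And>i. i \<in> I \<Longrightarrow> Ck_on k U (f i)"
  shows "Ck_on k U (\<lambda>x. \<Sum>i\<in>I. f i x)"
  using assms(2)
  by (induction I rule: infinite_finite_induct) (auto intro: Ck_on_const Ck_on_add assms(1))

lemma Ck_on_mult:
  fixes f g :: "'a::euclidean_space \<Rightarrow> 'b::{euclidean_space,real_normed_algebra}"
  assumes "open U" "Ck_on k U f" "Ck_on k U g"
  shows "Ck_on k U (\<lambda>x. f x * g x)"
  using assms(2,3)
proof (induction k arbitrary: f g)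
  case 0
  then show ?case
    by (auto intro: continuous_intros)
next
  case (Suc k)
  show ?case
  proof (rule Ck_on_SucI[OF assms(1), where
        f' = "\<lambda>x v. f x * frechet_derivative g (at x) v + frechet_derivative f (at x) v * g x"])
    show "Ck_on k U (\<lambda>x. f x * frechet_derivative g (at x) v + frechet_derivative f (at x) v * g x)"
      for v
      \<comment> \<open>The product rule mixes derivatives, known to be of class \<open>k\<close>,
        with the undifferentiated factors of class \<open>Suc k\<close>. The latter are lowered to
        class \<open>k\<close> before the induction hypothesis for products applies.\<close>
      using Suc Ck_on_SucD[OF Suc.prems(1)] Ck_on_SucD[OF Suc.prems(2)]
      by (auto intro!: Ck_on_add assms(1))
  qed (use Suc.prems Ck_on_Suc_has_derivative has_derivative_mult in blast)
qed

lemma Ck_on_inverse: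
  fixes f :: "'a::euclidean_space \<Rightarrow> 'b::{euclidean_space,real_normed_div_algebra}"
  assumes "open U" "Ck_on k U f" "\<And>x. x \<in> U \<Longrightarrow> f x \<noteq> 0"
  shows "Ck_on k U (\<lambda>x. inverse (f x))"
  using assms(2)
proof (induction k)
  case 0
  then show ?case
    using assms(3) by (auto intro: continuous_on_inverse)
next
  case (Suc k)
  show ?case
  proof (rule Ck_on_SucI[OF assms(1), where
        f' = "\<lambda>x v. - (inverse (f x) * frechet_derivative f (at x) v * inverse (f x))"])
    show "Ck_on k U (\<lambda>x. - (inverse (f x) * frechet_derivative f (at x) v * inverse (f x)))" for v
      \<comment> \<open>The derivative contains \<open>inverse (f x)\<close> itself, which the
        induction hypothesis supplies at class \<open>k\<close>.\<close>
      using Suc Ck_on_SucD[OF Suc.prems]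
      by (intro Ck_on_bounded_linear_compose[OF assms(1) bounded_linear_minus[OF bounded_linear_ident]]
          Ck_on_mult assms(1)) simp_all
    show "((\<lambda>x. inverse (f x)) has_derivative
        (\<lambda>v. - (inverse (f x) * frechet_derivative f (at x) v * inverse (f x)))) (at x)"
      if "x \<in> U" for x
      by (rule Deriv.has_derivative_inverse[OF assms(3)[OF that] Ck_on_Suc_has_derivative[OF Suc.prems that]])
  qed
qed

text \<open>A vector is the finite sum of its coordinates, each placed on its axis by a linear
  map.\<close>

lemma Ck_on_vec:
  fixes f :: "'a::euclidean_space \<Rightarrow> 'b::euclidean_space ^ 'n"
  assumes "open U" "\<And>i. Ck_on k U (\<lambda>x. f x $ i)"
  shows "Ck_on k U f"
proof -
  have "f = (\<lambda>x. \<Sum>i\<in>UNIV. axis i (f x $ i))"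
    by (auto simp: vec_eq_iff axis_def if_distrib cong: if_cong)
  moreover have "linear (axis i :: 'b \<Rightarrow> 'b ^ 'n)" for i
    by (rule linearI) (auto simp: vec_eq_iff axis_def)
  then have "Ck_on k U (\<lambda>x. \<Sum>i\<in>UNIV. axis i (f x $ i))"
    using assms by (intro Ck_on_sum Ck_on_bounded_linear_compose[where h = "axis _"])
      (auto simp: linear_linear)
  ultimately show ?thesis by simp
qed

section \<open>Smooth maps on arbitrary subsets\<close>

lemma smooth_on_open_imp_smooth_map_on:
  assumes "open S" "smooth_on_open S f"
  shows "smooth_map_on S f"
  using assms unfolding smooth_map_on_def by blast

lemma bounded_linear_imp_smooth_map_on: "bounded_linear f \<Longrightarrow> smooth_map_on S f"
  unfolding smooth_map_on_def smooth_on_open_def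
  by (metis Ck_on_bounded_linear UNIV_I open_UNIV)

lemma smooth_map_on_imp_continuous_on:
  assumes "smooth_map_on S f"
  shows "continuous_on S f"
  unfolding continuous_on_eq_continuous_within
proof
  fix p assume p: "p \<in> S"
  then obtain U g where U: "open U" "p \<in> U" "smooth_on_open U g" "\<forall>x\<in>S \<inter> U. g x = f x"
    using assms unfolding smooth_map_on_def by blast
  then have "continuous_on U g"
    by (metis Ck_on.simps(1) smooth_on_open_def)
  then have "continuous_on (S \<inter> U) f"
    using U(4) by (metis continuous_on_cong continuous_on_subset inf_le2)
  then have "continuous (at p within S \<inter> U) f"
    using U(2) p by (simp add: continuous_on_eq_continuous_within)
  \<comment> \<open>Continuity is local: the open neighbourhood \<open>U\<close> does not change the
    filter at \<open>p\<close>.\<close>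
  moreover have "at p within S \<inter> U = at p within S"
    using U(1,2) by (intro at_within_nhd[of p U]) auto
  ultimately show "continuous (at p within S) f"
    by simp
qed

lemma diffeomorphismI:
  assumes "smooth_map_on S f" "smooth_map_on T g"
    and "\<And>x. x \<in> S \<Longrightarrow> f x \<in> T" "\<And>y. y \<in> T \<Longrightarrow> g y \<in> S"
    and "\<And>x. x \<in> S \<Longrightarrow> g (f x) = x" "\<And>y. y \<in> T \<Longrightarrow> f (g y) = y"
  shows "diffeomorphism S T f g"
  using assms unfolding diffeomorphism_def
  by (auto intro!: homeomorphismI smooth_map_on_imp_continuous_on)

section \<open>Segments\<close>

lemma diag_set_iff: "z \<in> diag_set \<longleftrightarrow> (\<forall>k. z $ k = z $ j)"
  by (auto simp: diag_set_def vec_eq_iff)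

lemma collinear_translation_iff: "collinear ((+) a ` S) \<longleftrightarrow> collinear S"
  by (simp add: collinear_def)

lemma n_segments_translate: "(\<chi> i. z $ i + c) \<in> n_segments \<longleftrightarrow> z \<in> n_segments"
proof -
  have "range (\<lambda>i. z $ i + c) = (+) c ` range (($) z)"
    by (auto simp: image_image add.commute)
  then show ?thesis
    \<comment> \<open>Being diagonal can be tested against any reference index;
      \<open>undefined\<close> serves as an arbitrary one.\<close>
    by (simp add: n_segments_def collinear_translation_iff diag_set_iff[of _ undefined])
qed

lemma n_segments_diffeomorphic:
  fixes j :: "'n::finite"
  shows "(n_segments :: (complex ^ 'n) set) diffeomorphic (zero_segments j \<times> (UNIV :: complex set))"
proof -
  \<comment> \<open>Both maps are restrictions of real-linear maps between the ambient spaces, so no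
    charts are needed for smoothness. The form \<open>+ - z $ j\<close> lets
    \<open>n_segments_translate\<close> match, which is why \<open>add_uminus_conv_diff\<close> is
    switched off below.\<close>
  let ?f = "\<lambda>z :: complex ^ 'n. ((\<chi> i. z $ i + - z $ j) :: complex ^ 'n, z $ j)"
  let ?g = "\<lambda>(w :: complex ^ 'n, c :: complex). (\<chi> i. w $ i + c) :: complex ^ 'n"
  have "linear ?f"
    by (rule linearI) (auto simp: vec_eq_iff algebra_simps)
  moreover have "linear ?g"
    by (rule linearI) (auto simp: vec_eq_iff algebra_simps)
  ultimately have "diffeomorphism n_segments (zero_segments j \<times> UNIV) ?f ?g"
    by (intro diffeomorphismI bounded_linear_imp_smooth_map_on)
      (auto simp: linear_linear zero_segments_def first_zero_def n_segments_translate vec_eq_iff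
        simp del: add_uminus_conv_diff)
  then show ?thesis
    unfolding diffeomorphic_def by blast
qed

section \<open>Real ratios and the slice chart\<close>

lemma collinear_range_iff_ratios_real:
  fixes f :: "'n \<Rightarrow> complex"
  assumes "f k \<noteq> f j"
  shows "collinear (range f) \<longleftrightarrow> (\<forall>i. (f i - f j) / (f k - f j) \<in> \<real>)"
proof
  assume "collinear (range f)"
  then obtain u where u: "\<And>i l. \<exists>c. f i - f l = c *\<^sub>R u"
    unfolding collinear_def by blast
  show "\<forall>i. (f i - f j) / (f k - f j) \<in> \<real>"
  proof
    fix i
    obtain c d where "f i - f j = c *\<^sub>R u" "f k - f j = d *\<^sub>R u"
      using u by blast
    \<comment> \<open>The common direction \<open>u\<close> cancels; \<open>f k \<noteq> f j\<close>
      forces both \<open>u\<close> and \<open>d\<close> to be nonzero.\<close>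
    then have "(f i - f j) / (f k - f j) = of_real (c / d)"
      using assms by (auto simp: scaleR_conv_of_real)
    then show "(f i - f j) / (f k - f j) \<in> \<real>"
      by (metis Reals_of_real)
  qed
next
  assume "\<forall>i. (f i - f j) / (f k - f j) \<in> \<real>"
  then have "\<forall>i. \<exists>r. (f i - f j) / (f k - f j) = of_real r"
    by (auto elim: Reals_cases)
  then obtain r where r: "\<And>i. (f i - f j) / (f k - f j) = of_real (r i)"
    by metis
  \<comment> \<open>Conversely, \<open>f k - f j\<close> serves as the common direction.\<close>
  have "f i = f j + r i *\<^sub>R (f k - f j)" for i
    using r[of i] assms by (simp add: field_simps scaleR_conv_of_real)
  then have "f i - f l = (r i - r l) *\<^sub>R (f k - f j)" for i l
    by (metis add_diff_cancel_left scaleR_left_diff_distrib)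
  then show "collinear (range f)"
    unfolding collinear_def by blast
qed

text \<open>Entries \<open>j\<close> and \<open>k\<close> record the base point and the direction of
  the line through \<open>z $ j\<close> and \<open>z $ k\<close>. The other entries are the images
  of the points under the complex affine map sending \<open>z $ j\<close> to 0 and
  \<open>z $ k\<close> to 1.\<close>

definition ratio_chart :: "'n \<Rightarrow> 'n \<Rightarrow> complex ^ 'n \<Rightarrow> complex ^ 'n" where
  "ratio_chart j k z = (\<chi> i. if i = j then z $ j else if i = k then z $ k - z $ j
     else (z $ i - z $ j) / (z $ k - z $ j))"

definition ratio_chart_inv :: "'n \<Rightarrow> 'n \<Rightarrow> complex ^ 'n \<Rightarrow> complex ^ 'n" where
  "ratio_chart_inv j k w = (\<chi> i. if i = j then w $ j else if i = k then w $ j + w $ k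
     else w $ j + w $ i * w $ k)"

lemma open_vec_nth_diff: "open {z :: complex ^ 'n. z $ k \<noteq> z $ j}" "open {w :: complex ^ 'n. w $ k \<noteq> 0}"
  by (auto intro!: open_Collect_neq continuous_intros)

lemma diffeomorphism_ratio_chart:
  assumes "k \<noteq> j"
  shows "diffeomorphism {z. z $ k \<noteq> z $ j} {w. w $ k \<noteq> 0}
    (ratio_chart j k :: complex ^ 'n \<Rightarrow> complex ^ 'n) (ratio_chart_inv j k)"
proof (rule diffeomorphismI)
  let ?U = "{z :: complex ^ 'n. z $ k \<noteq> z $ j}"
  let ?V = "{w :: complex ^ 'n. w $ k \<noteq> 0}"
  have nth: "Ck_on m U (\<lambda>z. z $ i)" if "open U" for m i and U :: "(complex ^ 'n) set"
    using that by (intro Ck_on_bounded_linear bounded_linear_vec_nth)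
  have diff: "Ck_on m U (\<lambda>z. z $ i - z $ j)" if "open U" for m i and U :: "(complex ^ 'n) set"
    using that by (intro Ck_on_bounded_linear bounded_linear_sub bounded_linear_vec_nth)
  \<comment> \<open>The denominator vanishes nowhere on \<open>?U\<close>. The inverse chart is
    polynomial, so it needs only sums and products.\<close>
  have "Ck_on m ?U (\<lambda>z. (z $ i - z $ j) * inverse (z $ k - z $ j))" for m i
    by (intro Ck_on_mult Ck_on_inverse diff open_vec_nth_diff) auto
  then have "Ck_on m ?U (\<lambda>z. ratio_chart j k z $ i)" for m i
    using open_vec_nth_diff(1)[of k j]
    by (cases "i = j"; cases "i = k") (simp_all add: ratio_chart_def divide_inverse nth diff)
  then show "smooth_map_on ?U (ratio_chart j k)"
    by (intro smooth_on_open_imp_smooth_map_on open_vec_nth_diff)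
      (simp add: smooth_on_open_def Ck_on_vec open_vec_nth_diff)
  have "Ck_on m ?V (\<lambda>w. ratio_chart_inv j k w $ i)" for m i
    using open_vec_nth_diff(2)[of k]
    by (cases "i = j"; cases "i = k")
      (simp_all add: ratio_chart_inv_def nth Ck_on_add Ck_on_mult)
  then show "smooth_map_on ?V (ratio_chart_inv j k)"
    by (intro smooth_on_open_imp_smooth_map_on open_vec_nth_diff)
      (simp add: smooth_on_open_def Ck_on_vec open_vec_nth_diff)
qed (use assms in \<open>auto simp: ratio_chart_def ratio_chart_inv_def vec_eq_iff\<close>)

lemma n_segments_iff_ratio_chart:
  assumes "z $ k \<noteq> z $ j"
  shows "z \<in> n_segments \<longleftrightarrow> (\<forall>i. i \<noteq> j \<and> i \<noteq> k \<longrightarrow> Im (ratio_chart j k z $ i) = 0)"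
proof -
  have "z \<in> n_segments \<longleftrightarrow> (\<forall>i. (z $ i - z $ j) / (z $ k - z $ j) \<in> \<real>)"
    using assms collinear_range_iff_ratios_real[of "($) z" k j]
    by (auto simp: n_segments_def diag_set_iff[of z j])
  also have "\<dots> \<longleftrightarrow> (\<forall>i. i \<noteq> j \<and> i \<noteq> k \<longrightarrow> (z $ i - z $ j) / (z $ k - z $ j) \<in> \<real>)"
    \<comment> \<open>The ratio is 0 at \<open>i = j\<close> and 1 at \<open>i = k\<close>, hence
      real at both indices without any condition.\<close>
    using assms by (metis Reals_0 Reals_1 diff_self div_0 divide_self right_minus_eq)
  finally show ?thesis
    by (simp add: ratio_chart_def complex_is_Real_iff)
qed

section \<open>Dimension of the model subspace and the submanifold property\<close>

lemma subspace_dim_Im_zero: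
  fixes A :: "'n::finite set"
  defines "W \<equiv> {w :: complex ^ 'n. \<forall>i. i \<notin> A \<longrightarrow> Im (w $ i) = 0}"
  shows "subspace W" "dim W = CARD('n) + card A"
proof -
  show "subspace W"
    by (auto simp: W_def subspace_def)
  \<comment> \<open>Every index contributes a real direction, and an index in \<open>A\<close> an
    imaginary one as well.\<close>
  let ?r = "\<lambda>i::'n. axis i (1::complex)" and ?c = "\<lambda>i::'n. axis i \<i>"
  let ?d = "range ?r \<union> ?c ` A"
  have d: "?d \<subseteq> Basis"
    by (auto simp: Basis_vec_def Basis_complex_def)
  \<comment> \<open>Pairing with an imaginary basis vector extracts an imaginary part, so
    \<open>W\<close> is cut out by the vanishing of the coordinates outside
    \<open>?d\<close>.\<close>
  have "W = {w. \<forall>b\<in>Basis. b \<notin> ?d \<longrightarrow> w \<bullet> b = 0}"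
    by (auto simp: W_def Basis_vec_def Basis_complex_def inner_axis axis_eq_axis image_iff)
  then have "dim W = card ?d"
    using dim_substandard[OF d] by simp
  also have "\<dots> = card (range ?r) + card (?c ` A)"
    by (rule card_Un_disjoint) (auto simp: axis_eq_axis)
  also have "card (range ?r) = CARD('n)"
    by (intro card_image) (auto simp: inj_on_def axis_eq_axis)
  also have "card (?c ` A) = card A"
    by (intro card_image) (auto simp: inj_on_def axis_eq_axis)
  finally show "dim W = CARD('n) + card A" .
qed

lemma smooth_submanifold_n_segments:
  "smooth_submanifold (CARD('n) + 2) (n_segments :: (complex ^ 'n) set)"
  unfolding smooth_submanifold_def
proof
  fix p :: "complex ^ 'n"
  assume "p \<in> n_segments"
  \<comment> \<open>Off the diagonal some coordinate of \<open>p\<close> differs from the reference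
    one. The pair found here selects the chart around \<open>p\<close>.\<close>
  then obtain j k where p: "p $ k \<noteq> p $ j"
    unfolding n_segments_def diag_set_iff[of _ undefined] by blast
  then have kj: "k \<noteq> j" by auto
  let ?U = "{z :: complex ^ 'n. z $ k \<noteq> z $ j}"
  let ?V = "{w :: complex ^ 'n. w $ k \<noteq> 0}"
  let ?W = "{w :: complex ^ 'n. \<forall>i. i \<notin> {j, k} \<longrightarrow> Im (w $ i) = 0}"
  have diffeo: "diffeomorphism ?U ?V (ratio_chart j k) (ratio_chart_inv j k)"
    using kj by (rule diffeomorphism_ratio_chart)
  then have "ratio_chart j k ` ?U = ?V"
    by (auto simp: diffeomorphism_def homeomorphism_def)
  moreover have "z \<in> n_segments \<longleftrightarrow> ratio_chart j k z \<in> ?W" if "z \<in> ?U" for z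
    using n_segments_iff_ratio_chart[of z k j] that by auto
  then have "n_segments \<inter> ?U = ?U \<inter> ratio_chart j k -` ?W"
    by blast
  \<comment> \<open>Inside \<open>?U\<close> the segments are the preimage of \<open>?W\<close>, and
    the chart maps \<open>?U\<close> onto \<open>?V\<close>.\<close>
  ultimately have "ratio_chart j k ` (n_segments \<inter> ?U) = ?W \<inter> ?V"
    by auto
  \<comment> \<open>The extra 2 counts the imaginary parts of the two unrestricted entries, which
    are distinct by \<open>kj\<close>.\<close>
  moreover have "subspace ?W" "dim ?W = CARD('n) + 2"
    using subspace_dim_Im_zero[of "{j, k}"] kj by auto
  ultimately show "\<exists>(U :: (complex ^ 'n) set) (V :: (complex ^ 'n) set) W \<phi> \<psi>.
      open U \<and> p \<in> U \<and> open V \<and> diffeomorphism U V \<phi> \<psi> \<and>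
      subspace W \<and> dim W = CARD('n) + 2 \<and> \<phi> ` (n_segments \<inter> U) = W \<inter> V"
    using diffeo p open_vec_nth_diff(1)[of k j] open_vec_nth_diff(2)[of k]
    by (intro exI[of _ ?U] exI[of _ ?V] exI[of _ ?W] exI[of _ "ratio_chart j k"]
        exI[of _ "ratio_chart_inv j k"] conjI) simp_all
qed

theorem corollary2p2:
  fixes j :: "'n::finite"
  assumes "CARD('n) \<ge> 3"
  shows "smooth_submanifold (CARD('n) + 2) (n_segments :: (complex ^ 'n) set) \<and>
    (n_segments :: (complex ^ 'n) set) diffeomorphic (zero_segments j \<times> (UNIV :: complex set))"
  using smooth_submanifold_n_segments n_segments_diffeomorphic by blast

end
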